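(* If $X$ is a Hausdorff cellular-Lindelöf $P$-space of character $\omega_1$, then $|X| \leq 2^{\omega_1}$.
   Context: A $P$-space is a topological space in which every $G_\delta$ set (countable intersection of open sets) is open. The character of $X$ is the least infinite cardinal $\kappa$ such that every point of $X$ has a local base of cardinality at most $\kappa$. A space is Lindelöf if every open cover has a countable subcover. A space $X$ is cellular-Lindelöf if for every family $\mathcal{U}$ of pairwise disjoint non-empty open subsets of $X$ there is a Lindelöf subspace $Y \subset X$ such that $U \cap Y \neq \emptyset$ for every $U \in \mathcal{U}$. *)

theory Defs
  imports "HOL-Analysis.Analysis"
begin

unbundle cardinal_syntax

definition P_space :: "'a topology \<Rightarrow> bool" where
  "P_space X \<longleftrightarrow> (\<forall>S. gdelta_in X S \<longrightarrow> openin X S)"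

definition cellular_Lindelof_space :: "'a topology \<Rightarrow> bool" where
  "cellular_Lindelof_space X \<longleftrightarrow>
     (\<forall>\<U>. (\<forall>U \<in> \<U>. openin X U \<and> U \<noteq> {}) \<and> pairwise disjnt \<U> \<longrightarrow>
        (\<exists>Y. Y \<subseteq> topspace X \<and> Lindelof_space (subtopology X Y) \<and> (\<forall>U \<in> \<U>. U \<inter> Y \<noteq> {})))"

definition local_base_at :: "'a topology \<Rightarrow> 'a \<Rightarrow> 'a set set \<Rightarrow> bool" where
  "local_base_at X x \<B> \<longleftrightarrow>
     (\<forall>B \<in> \<B>. openin X B \<and> x \<in> B) \<and>
     (\<forall>U. openin X U \<and> x \<in> U \<longrightarrow> (\<exists>B \<in> \<B>. B \<subseteq> U))"

definition local_bases_bounded_by :: "'a topology \<Rightarrow> 'b rel \<Rightarrow> bool" where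
  "local_bases_bounded_by X \<kappa> \<longleftrightarrow>
     (\<forall>x \<in> topspace X. \<exists>\<B>. local_base_at X x \<B> \<and> |\<B>| \<le>o \<kappa>)"

text \<open>
  The character of a space equals the cardinal \<open>\<kappa>\<close>, a relation in the sense of the cardinal
  library.  Minimality is only demanded among cardinals living on the same type as \<open>\<kappa>\<close>; this
  is no restriction, since every cardinal below \<open>\<kappa>\<close> has an isomorphic copy on that type, as
  lemma \<open>has_character_minimal\<close> confirms.
\<close>

definition has_character :: "'a topology \<Rightarrow> 'b rel \<Rightarrow> bool" where
  "has_character X \<kappa> \<longleftrightarrow>
     Cinfinite \<kappa> \<and> local_bases_bounded_by X \<kappa> \<and>
     (\<forall>\<mu> :: 'b rel. Cinfinite \<mu> \<and> local_bases_bounded_by X \<mu> \<longrightarrow> \<kappa> \<le>o \<mu>)"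

lemma has_character_minimal:
  fixes \<kappa> :: "'b rel" and \<mu> :: "'c rel"
  assumes "has_character X \<kappa>" "Cinfinite \<mu>" "local_bases_bounded_by X \<mu>"
  shows "\<kappa> \<le>o \<mu>"
proof (rule ccontr)
  assume "\<not> \<kappa> \<le>o \<mu>"
  have \<kappa>: "Card_order \<kappa>" and \<mu>: "Card_order \<mu>" "\<not> finite (Field \<mu>)"
    using assms by (auto simp: has_character_def cinfinite_def)
  then have "\<mu> <o \<kappa>"
    using \<open>\<not> \<kappa> \<le>o \<mu>\<close> by (simp add: card_order_on_well_order_on not_ordLeq_iff_ordLess)
  then have "|Field \<mu>| \<le>o |Field \<kappa>|"
    using \<kappa> \<mu> by (meson card_of_mono2 ordLess_imp_ordLeq)
  then obtain f :: "'c \<Rightarrow> 'b" where f: "inj_on f (Field \<mu>)"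
    by (meson card_of_ordLeq)
  define \<nu> where "\<nu> = |f ` Field \<mu>|"
  have "|Field \<mu>| =o \<nu>"
    unfolding \<nu>_def using f by (meson card_of_ordIso inj_on_imp_bij_betw)
  then have eq: "\<mu> =o \<nu>"
    using \<mu> card_of_Field_ordIso ordIso_symmetric ordIso_transitive by blast
  have "Cinfinite \<nu>"
    unfolding \<nu>_def cinfinite_def using \<mu> f by (simp add: finite_image_iff Field_card_of card_of_card_order_on)
  moreover have "local_bases_bounded_by X \<nu>"
    using assms(3) eq unfolding local_bases_bounded_by_def by (meson ordLeq_ordIso_trans)
  ultimately have "\<kappa> \<le>o \<nu>"
    using assms(1) by (simp add: has_character_def)
  then show False
    using eq \<open>\<not> \<kappa> \<le>o \<mu>\<close> by (meson ordIso_symmetric ordLeq_ordIso_trans)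
qed

definition omega_1 :: "nat set rel" where
  "omega_1 = cardSuc natLeq"

end

theory Submission
  imports Defs
begin

text \<open>
  In a Hausdorff \<open>P\<close>-space of character \<open>\<omega>\<^sub>1\<close>, Lindelof subspaces are closed, and every non-isolated
  point is the limit of a cellular family of size \<open>\<omega>\<^sub>1\<close>.  Placing such families inside pairwise
  disjoint neighbourhoods of the points of a set \<open>H\<close> shows that any Lindelof subspace meeting all of
  their members contains \<open>H\<close>.  Cellular-Lindelofness is therefore used only to see that \<open>H\<close> has
  Lindelof closure as soon as its points can be separated simultaneously by disjoint open sets.

  Now close off to a set \<open>A\<close> of size at most \<open>2\<^sup>\<kappa>\<close>, \<open>\<kappa> = \<omega>\<^sub>1\<close>, that is closed in \<open>X\<close> and reflects, for each
  \<open>S \<subseteq> A\<close> of size at most \<open>\<kappa>\<close>, the existence of a point having a basic neighbourhood disjoint from a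
  prescribed basic neighbourhood of each \<open>x \<in> S\<close>.  If some point \<open>p\<close> lay outside \<open>A\<close>, attach to each
  \<open>x \<in> A\<close> the indices \<open>u x = (i, j)\<close> of disjoint basic neighbourhoods of \<open>x\<close> and \<open>p\<close>, and choose points
  \<open>f \<alpha> \<in> A\<close>, \<open>\<alpha> < \<kappa>\<^sup>+\<close>, that look like \<open>p\<close> to all previous points (as in the Erdos-Rado theorem) and
  that avoid countable covers of the closures of the previous homogeneous sets (as in the
  Pol-Shapirovskii method).  A homogeneous set \<open>H\<close> of size \<open>\<kappa>\<^sup>+\<close> is separated, hence has Lindelof closure,
  while each point of its closure has a neighbourhood meeting \<open>H\<close> in at most \<open>\<kappa>\<close> points.
\<close>

subsection \<open>Cardinal arithmetic and closing off\<close>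

lemma Cinfinite_two_cexp: "Cinfinite \<kappa> \<Longrightarrow> Cinfinite (ctwo ^c \<kappa>)"
  by (simp add: Cinfinite_cexp Card_order_ctwo ordLeq_refl)

lemma finite_ordLeq_Cinfinite:
  assumes "finite A" "Cinfinite r"
  shows "|A| \<le>o r"
proof -
  have "|A| \<le>o |Field r|"
    using assms by (intro ordLess_imp_ordLeq finite_ordLess_infinite card_of_Well_order)
      (auto simp: cinfinite_def Field_card_of)
  then show ?thesis
    using assms card_of_Field_ordIso ordLeq_ordIso_trans by blast
qed

text \<open>The bound is (2^\<kappa>)^\<kappa> = 2^(\<kappa> * \<kappa>) = 2^\<kappa>. An empty
  \<open>I\<close> is treated apart because 0^0 = 1 breaks monotonicity in the exponent.\<close>

lemma card_of_Func_ordLeq_cexp: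
  assumes \<kappa>: "Cinfinite \<kappa>" and I: "|I| \<le>o \<kappa>" and B: "|B| \<le>o ctwo ^c \<kappa>"
  shows "|Func I B| \<le>o ctwo ^c \<kappa>"
proof (cases "I = {}")
  case True
  then show ?thesis
    using \<kappa> by (simp add: Func_empty finite_ordLeq_Cinfinite Cinfinite_two_cexp)
next
  case False
  have "|Func I B| = |B| ^c |I|"
    by (simp add: cexp_def Field_card_of)
  also have "|B| ^c |I| \<le>o (ctwo ^c \<kappa>) ^c \<kappa>"
    using cexp_mono'[OF B I] False by (simp add: Field_card_of)
  also have "(ctwo ^c \<kappa>) ^c \<kappa> =o ctwo ^c \<kappa>"
    using \<kappa> by (intro cexp_cprod_ordLeq Card_order_ctwo Cinfinite_Cnotzero) (auto intro: ordLeq_refl)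
  finally show ?thesis .
qed

lemma ordLeq_Card_order_surj:
  assumes "|S| \<le>o \<kappa>" "Card_order \<kappa>" "S \<noteq> {}"
  obtains f where "f ` Field \<kappa> = S"
proof -
  have "|S| \<le>o |Field \<kappa>|"
    using assms by (meson card_of_Field_ordIso ordIso_symmetric ordLeq_ordIso_trans)
  then show thesis
    using assms(3) that by (metis card_of_ordLeq2)
qed

lemma Cinfinite_Field_ordLeq: "Cinfinite \<kappa> \<Longrightarrow> |Field \<kappa>| \<le>o \<kappa>"
  using card_of_Field_ordIso ordIso_imp_ordLeq by blast

lemma Cinfinite_Times_Field_ordLeq: "Cinfinite \<kappa> \<Longrightarrow> |Field \<kappa> \<times> Field \<kappa>| \<le>o \<kappa>"
  by (simp add: card_of_Times_ordLeq_infinite_Field cinfinite_def Cinfinite_Field_ordLeq)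

lemma countable_ordLeq_Cinfinite:
  assumes "countable A" "Cinfinite r"
  shows "|A| \<le>o r"
proof -
  have "|A| \<le>o |UNIV :: nat set|"
    using assms by (meson card_of_ordLeq countable_def subset_UNIV)
  then show ?thesis
    using assms natLeq_ordLeq_cinfinite card_of_nat ordLeq_ordIso_trans ordLeq_transitive by blast
qed

text \<open>Apply \<open>F\<close> repeatedly along \<kappa>^+ stages. A set of size 2^\<kappa> has
  at most (2^\<kappa>)^\<kappa> = 2^\<kappa> subsets of size at most \<kappa>, so no stage outgrows
  2^\<kappa>. By regularity of \<kappa>^+, a small subset of the union already lies in one
  stage.\<close>

lemma closing_off:
  fixes \<kappa> :: "'b rel" and F :: "'a set \<Rightarrow> 'a set"
  assumes \<kappa>: "Cinfinite \<kappa>"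
    and F: "\<And>S. |S| \<le>o \<kappa> \<Longrightarrow> |F S| \<le>o ctwo ^c \<kappa>"
  obtains A where "|A| \<le>o ctwo ^c \<kappa>" "\<And>S. \<lbrakk>S \<subseteq> A; |S| \<le>o \<kappa>\<rbrakk> \<Longrightarrow> F S \<subseteq> A"
proof -
  define \<mu> where "\<mu> = ctwo ^c \<kappa>"
  define r where "r = cardSuc \<kappa>"
  define G where "G Z = Z \<union> \<Union> (F ` {S. S \<subseteq> Z \<and> |S| \<le>o \<kappa>})" for Z
  have \<mu>: "Cinfinite \<mu>"
    using \<kappa> Cinfinite_two_cexp unfolding \<mu>_def by blast
  have r: "Card_order r" "Well_order r" "Cinfinite r"
    using \<kappa> by (auto simp: r_def cardSuc_Well_order Cinfinite_cardSuc cardSuc_Card_order)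
  have r_le: "|Field r| \<le>o \<mu>"
    using \<kappa> ordLess_ctwo_cexp[of \<kappa>] cardSuc_least[of \<kappa> \<mu>] \<mu> r card_of_Field_ordIso ordIso_ordLeq_trans
    unfolding r_def \<mu>_def by blast
  have G_card: "|G Z| \<le>o \<mu>" if Z: "|Z| \<le>o \<mu>" for Z
  proof -
    \<comment> \<open>Small subsets are counted as images of \<open>Field \<kappa>\<close>; the
      empty set is no image of this nonempty index set and is added by hand.\<close>
    have "{S. S \<subseteq> Z \<and> |S| \<le>o \<kappa>} \<subseteq> insert {} ((\<lambda>f. f ` Field \<kappa>) ` Func (Field \<kappa>) Z)"
    proof (clarsimp)
      fix S assume S: "S \<subseteq> Z" "|S| \<le>o \<kappa>" "S \<notin> (\<lambda>f. f ` Field \<kappa>) ` Func (Field \<kappa>) Z"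
      show "S = {}"
      proof (rule ccontr)
        assume "S \<noteq> {}"
        then obtain f where f: "f ` Field \<kappa> = S"
          using ordLeq_Card_order_surj S(2) \<kappa> by metis
        define g where "g x = (if x \<in> Field \<kappa> then f x else undefined)" for x
        have "g \<in> Func (Field \<kappa>) Z" "g ` Field \<kappa> = S"
          using f S by (auto simp: g_def Func_def)
        then show False using S by blast
      qed
    qed
    moreover have "|Func (Field \<kappa>) Z| \<le>o \<mu>"
      using card_of_Func_ordLeq_cexp[of \<kappa> "Field \<kappa>" Z] Z \<kappa> card_of_Field_ordIso ordIso_imp_ordLeq
      unfolding \<mu>_def by blast
    then have "|(\<lambda>f. f ` Field \<kappa>) ` Func (Field \<kappa>) Z| \<le>o \<mu>"
      using card_of_image ordLeq_transitive by blast
    then have "|{{}} \<union> (\<lambda>f. f ` Field \<kappa>) ` Func (Field \<kappa>) Z| \<le>o \<mu>"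
      using \<mu> by (intro Un_Cinfinite_bound[OF finite_ordLeq_Cinfinite]) simp_all
    ultimately have "|{S. S \<subseteq> Z \<and> |S| \<le>o \<kappa>}| \<le>o \<mu>"
      by (metis (no_types, lifting) card_of_mono1 insert_is_Un ordLeq_transitive)
    then show ?thesis
      unfolding G_def
      using Z \<mu> F by (intro Un_Cinfinite_bound UNION_Cinfinite_bound) (auto simp: \<mu>_def)
  qed
  have "wf (r - Id)"
    using r by (simp add: well_order_on_def)
  then have "\<exists>Z. \<forall>\<alpha>. Z \<alpha> = G (\<Union> (Z ` underS r \<alpha>))"
  proof (rule dependent_wf_choice)
    show "(Y = G (\<Union> (f ` underS r \<alpha>))) = (Y = G (\<Union> (g ` underS r \<alpha>)))"
      if "\<And>\<beta>. (\<beta>, \<alpha>) \<in> r - Id \<Longrightarrow> f \<beta> = g \<beta>" for f g :: "'b set \<Rightarrow> 'a set" and \<alpha> Y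
    proof -
      have "f ` underS r \<alpha> = g ` underS r \<alpha>"
        using that by (intro image_cong) (auto simp: underS_def)
      then show ?thesis by simp
    qed
  qed blast
  then obtain Z where Z: "\<And>\<alpha>. Z \<alpha> = G (\<Union> (Z ` underS r \<alpha>))"
    by blast
  have Z_card: "\<alpha> \<in> Field r \<longrightarrow> |Z \<alpha>| \<le>o \<mu>" for \<alpha>
    using \<open>wf (r - Id)\<close>
  proof (induction \<alpha> rule: wf_induct_rule)
    case (less \<alpha>)
    have "|\<Union> (Z ` underS r \<alpha>)| \<le>o \<mu>"
    proof (intro UNION_Cinfinite_bound ballI)
      show "|underS r \<alpha>| \<le>o \<mu>"
        using r_le card_of_mono1[of "underS r \<alpha>" "Field r"] ordLeq_transitive
        by (fastforce simp: underS_def Field_def)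
      show "|Z \<beta>| \<le>o \<mu>" if "\<beta> \<in> underS r \<alpha>" for \<beta>
        using that less by (auto simp: underS_def Field_def)
    qed (use \<mu> in auto)
    then show ?case
      using G_card Z by metis
  qed
  have G_increasing: "Y \<subseteq> G Y" for Y
    by (auto simp: G_def)
  have chain: "relChain r Z"
    unfolding relChain_def
  proof (intro allI impI)
    fix \<beta> \<alpha> assume "(\<beta>, \<alpha>) \<in> r"
    then have "\<beta> = \<alpha> \<or> Z \<beta> \<subseteq> \<Union> (Z ` underS r \<alpha>)"
      by (auto simp: underS_def)
    then show "Z \<beta> \<subseteq> Z \<alpha>"
      using G_increasing Z by blast
  qed
  define A where "A = \<Union> (Z ` Field r)"
  show thesis
  proof
    show "|A| \<le>o ctwo ^c \<kappa>"
      unfolding A_def using r_le Z_card \<mu> UNION_Cinfinite_bound \<mu>_def by blast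
    fix S assume S: "S \<subseteq> A" "|S| \<le>o \<kappa>"
    then obtain \<alpha> where \<alpha>: "\<alpha> \<in> Field r" "S \<subseteq> Z \<alpha>"
      using cardSuc_UNION_Cinfinite[of \<kappa> Z S] \<kappa> chain unfolding A_def r_def by blast
    \<comment> \<open>\<open>Z \<gamma>\<close> applies \<open>G\<close> to the union of strictly
      earlier stages, so a stage strictly after \<alpha> is required.\<close>
    obtain \<gamma> where \<gamma>: "\<gamma> \<in> Field r" "\<alpha> \<in> underS r \<gamma>"
      using infinite_Card_order_limit[of r \<alpha>] r \<alpha> by (auto simp: cinfinite_def underS_def Field_def)
    have "F S \<subseteq> G (\<Union> (Z ` underS r \<gamma>))"
      unfolding G_def using S \<alpha> \<gamma> by blast
    then show "F S \<subseteq> A"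
      using Z \<gamma> unfolding A_def by blast
  qed
qed

text \<open>This lets a recursion along \<open>omega_1\<close> intersect the open sets from all
  earlier steps without leaving the open sets of a P-space.\<close>

lemma countable_underS_omega_1:
  assumes "i \<in> Field omega_1"
  shows "countable (underS omega_1 i)"
proof -
  have "|underS omega_1 i| <o omega_1"
    using assms by (intro card_of_underS) (simp_all add: omega_1_def cardSuc_Card_order natLeq_Card_order)
  then have "|underS omega_1 i| \<le>o natLeq"
    unfolding omega_1_def using cardSuc_ordLeq_ordLess card_of_Card_order natLeq_Card_order by blast
  then have "|underS omega_1 i| \<le>o |UNIV :: nat set|"
    using card_of_nat ordIso_symmetric ordLeq_ordIso_trans by blast
  then show ?thesis
    by (meson card_of_ordLeq countable_def)
qed

lemma Cinfinite_omega_1: "Cinfinite omega_1"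
  unfolding omega_1_def by (rule Cinfinite_cardSuc[OF natLeq_Cinfinite])

subsection \<open>Separated sets in cellular-Lindelof \<open>P\<close>-spaces\<close>

lemma openin_INT_P_space:
  assumes "P_space X" "countable I" "I \<noteq> {}" "\<And>i. i \<in> I \<Longrightarrow> openin X (U i)"
  shows "openin X (\<Inter>i\<in>I. U i)"
  using assms gdelta_in_Inter[of "U ` I" X] open_imp_gdelta_in unfolding P_space_def by blast

text \<open>The proof that compact sets in Hausdorff spaces are closed carries over: the finite
  subcover becomes a countable one, and the countable intersection of neighbourhoods of the outside
  point is open in a P-space.\<close>

lemma closedin_Lindelof_subspace:
  assumes X: "Hausdorff_space X" "P_space X"
    and Y: "Y \<subseteq> topspace X" "Lindelof_space (subtopology X Y)"
  shows "closedin X Y"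
proof -
  have "\<exists>W. openin X W \<and> x \<in> W \<and> W \<subseteq> topspace X - Y" if x: "x \<in> topspace X - Y" for x
  proof -
    have "\<exists>U V. openin X U \<and> openin X V \<and> y \<in> U \<and> x \<in> V \<and> disjnt U V" if "y \<in> Y" for y
      using X x Y that unfolding Hausdorff_space_def by (metis DiffE subset_iff)
    then obtain U V where UV: "\<And>y. y \<in> Y \<Longrightarrow> openin X (U y) \<and> openin X (V y) \<and> y \<in> U y \<and> x \<in> V y \<and> disjnt (U y) (V y)"
      by metis
    have "(\<forall>W \<in> U ` Y. openin X W) \<and> Y \<subseteq> \<Union> (U ` Y)"
      using UV by blast
    then obtain \<V> where "countable \<V>" "\<V> \<subseteq> U ` Y" "Y \<subseteq> \<Union> \<V>"
      using Y Lindelof_space_subtopology_subset by metis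
    then obtain C where C: "countable C" "C \<subseteq> Y" "Y \<subseteq> \<Union> (U ` C)"
      by (metis countable_subset_image)
    define W where "W = topspace X \<inter> (\<Inter>y\<in>C. V y)"
    have "openin X W"
    proof (cases "C = {}")
      case False
      then show ?thesis
        unfolding W_def using C UV X by (intro openin_Int openin_topspace openin_INT_P_space) auto
    qed (simp add: W_def)
    moreover have "x \<in> W" "W \<subseteq> topspace X - Y"
      using x C UV unfolding W_def disjnt_def by blast+
    ultimately show ?thesis by blast
  qed
  then have "openin X (topspace X - Y)"
    by (subst openin_subopen) blast
  then show ?thesis
    using Y by (simp add: closedin_def)
qed

text \<open>If \<open>x\<close> is isolated, \<open>{{x}}\<close> works. Otherwise choose for each
  index \<open>i\<close> a nonempty open set inside \<open>V i\<close> that misses a neighbourhood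
  of \<open>x\<close>, and keep all later sets inside that neighbourhood. This makes the sets
  disjoint, and running through the whole local base makes them converge to
  \<open>x\<close>.\<close>

lemma converging_cellular_family:
  fixes X :: "'a topology" and V :: "nat set \<Rightarrow> 'a set"
  assumes X: "Hausdorff_space X" "P_space X"
    and V: "local_base_at X x (V ` Field omega_1)"
    and O: "openin X O'" "x \<in> O'"
  shows "\<exists>\<C>. (\<forall>C\<in>\<C>. openin X C \<and> C \<noteq> {} \<and> C \<subseteq> O') \<and> pairwise disjnt \<C> \<and>
    (\<forall>U. openin X U \<and> x \<in> U \<longrightarrow> (\<exists>C\<in>\<C>. C \<subseteq> U))"
proof (cases "openin X {x}")
  case True
  then show ?thesis
    using O by (intro exI[of _ "{{x}}"]) auto
next
  case False
  define r where "r = omega_1"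
  have r: "Well_order r" "countable (underS r i)" for i
    using countable_underS_omega_1[of i] Cinfinite_omega_1 underS_empty[of i r]
    unfolding r_def card_order_on_def by (cases "i \<in> Field omega_1"; auto)+
  \<comment> \<open>In the pair \<open>(A, B)\<close>, \<open>A\<close> is the new member of the
    family and \<open>B\<close> the neighbourhood of \<open>x\<close> reserved for all later
    members.\<close>
  define P where "P f i q \<longleftrightarrow> i \<in> Field r \<longrightarrow>
      (case q of (A, B) \<Rightarrow> openin X A \<and> openin X B \<and> A \<noteq> {} \<and> x \<in> B \<and> disjnt A B
        \<and> A \<subseteq> O' \<inter> V i \<and> (\<forall>j \<in> underS r i. A \<subseteq> snd (f j)))"
    for f :: "nat set \<Rightarrow> 'a set \<times> 'a set" and i q
  have "\<exists>f. \<forall>i. P f i (f i)"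
  proof (rule dependent_wf_choice)
    show "wf (r - Id)"
      using r by (simp add: well_order_on_def)
    show "P f i q = P g i q" if "\<And>j. (j, i) \<in> r - Id \<Longrightarrow> f j = g j" for f g i q
      using that by (auto simp: P_def underS_def)
    show "\<exists>q. P f i q" if IH: "\<And>j. (j, i) \<in> r - Id \<Longrightarrow> P f j (f j)" for f i
    proof (cases "i \<in> Field r")
      case True
      have B: "openin X (snd (f j))" "x \<in> snd (f j)" if "j \<in> underS r i" for j
        using IH[of j] that by (auto simp: P_def underS_def Field_def)
      have Vi: "openin X (V i)" "x \<in> V i"
        using V True unfolding local_base_at_def r_def by auto
      \<comment> \<open>The index \<open>i\<close> is inserted to make the intersection nonempty
        also at the least index.\<close>
      define W where "W = O' \<inter> V i \<inter> (\<Inter>j\<in>insert i (underS r i). if j = i then V i else snd (f j))"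
      have W: "openin X W"
        unfolding W_def using O Vi B r X
        by (intro openin_Int openin_INT_P_space) auto
      have xW: "x \<in> W"
        unfolding W_def using O Vi B by auto
      have "W \<noteq> {x}"
        using W False by blast
      then obtain z where z: "z \<in> W" "z \<noteq> x"
        using xW by blast
      have "z \<in> topspace X" "x \<in> topspace X"
        using W openin_subset z xW by blast+
      then obtain A B where AB: "openin X A" "openin X B" "z \<in> A" "x \<in> B" "disjnt A B"
        using X(1) z(2) unfolding Hausdorff_space_def by meson
      have "W \<subseteq> snd (f j)" if "j \<in> underS r i" for j
        using that by (auto simp: W_def underS_def)
      moreover have "W \<subseteq> O' \<inter> V i"
        by (auto simp: W_def)
      ultimately have "P f i (A \<inter> W, B)"
        using AB z W unfolding P_def by (auto simp: disjnt_def)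
      then show ?thesis by blast
    qed (simp add: P_def)
  qed
  then obtain f where f: "\<And>i. P f i (f i)" by blast
  define A where "A i = fst (f i)" for i
  have A: "openin X (A i)" "A i \<noteq> {}" "A i \<subseteq> O'" "A i \<subseteq> V i" if "i \<in> Field r" for i
    using f[of i] that by (auto simp: P_def A_def split: prod.splits)
  have disj: "disjnt (A j) (A i)" if "i \<in> Field r" "j \<in> underS r i" for i j
  proof -
    have "A i \<subseteq> snd (f j)"
      using f[of i] that by (auto simp: P_def A_def split: prod.splits)
    moreover have "disjnt (A j) (snd (f j))"
      using f[of j] that by (auto simp: P_def A_def underS_def Field_def split: prod.splits)
    ultimately show ?thesis
      by (auto simp: disjnt_def)
  qed
  show ?thesis
  proof (intro exI[of _ "A ` Field r"] conjI)
    show "\<forall>C\<in>A ` Field r. openin X C \<and> C \<noteq> {} \<and> C \<subseteq> O'"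
      using A by auto
    show "pairwise disjnt (A ` Field r)"
    proof (rule pairwiseI; clarify)
      fix i j assume ij: "i \<in> Field r" "j \<in> Field r" "A i \<noteq> A j"
      then have "i \<in> underS r j \<or> j \<in> underS r i"
        using r(1) unfolding well_order_on_def linear_order_on_def total_on_def underS_def by auto
      then show "disjnt (A i) (A j)"
        using ij disj disjnt_sym by blast
    qed
    show "\<forall>U. openin X U \<and> x \<in> U \<longrightarrow> (\<exists>C\<in>A ` Field r. C \<subseteq> U)"
    proof (intro allI impI)
      fix U assume "openin X U \<and> x \<in> U"
      then obtain i where "i \<in> Field r" "V i \<subseteq> U"
        using V unfolding local_base_at_def r_def by blast
      then show "\<exists>C\<in>A ` Field r. C \<subseteq> U"
        using A(4) by blast
    qed
  qed
qed

text \<open>Converging families placed inside the disjoint sets \<open>O' x\<close> form one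
  cellular family. A Lindelof \<open>Y\<close> meeting all its members has every point of
  \<open>H\<close> in its closure; since \<open>Y\<close> is closed it contains
  \<open>X closure_of H\<close>, which is then a closed subspace of a Lindelof space.\<close>

lemma Lindelof_closure_of_separated:
  fixes X :: "'a topology" and V :: "'a \<Rightarrow> nat set \<Rightarrow> 'a set"
  assumes X: "Hausdorff_space X" "P_space X" "cellular_Lindelof_space X"
    and V: "\<And>x. x \<in> topspace X \<Longrightarrow> local_base_at X x (V x ` Field omega_1)"
    and O: "\<And>x. x \<in> H \<Longrightarrow> openin X (O' x) \<and> x \<in> O' x" "disjoint_family_on O' H"
  shows "Lindelof_space (subtopology X (X closure_of H))"
proof -
  have H: "H \<subseteq> topspace X"
    using O(1) openin_subset by (meson subset_iff)
  have "\<exists>\<C>. (\<forall>C\<in>\<C>. openin X C \<and> C \<noteq> {} \<and> C \<subseteq> O' x) \<and> pairwise disjnt \<C> \<and>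
      (\<forall>U. openin X U \<and> x \<in> U \<longrightarrow> (\<exists>C\<in>\<C>. C \<subseteq> U))" if "x \<in> H" for x
    using converging_cellular_family[OF X(1,2) V, of x "O' x"] that H O(1) by blast
  then obtain \<C> where \<C>: "\<And>x. x \<in> H \<Longrightarrow> (\<forall>C\<in>\<C> x. openin X C \<and> C \<noteq> {} \<and> C \<subseteq> O' x) \<and>
      pairwise disjnt (\<C> x) \<and> (\<forall>U. openin X U \<and> x \<in> U \<longrightarrow> (\<exists>C\<in>\<C> x. C \<subseteq> U))"
    by metis
  have "pairwise disjnt (\<Union> (\<C> ` H))"
  proof (rule pairwiseI)
    fix C D assume "C \<in> \<Union> (\<C> ` H)" "D \<in> \<Union> (\<C> ` H)" "C \<noteq> D"
    then obtain x y where xy: "x \<in> H" "y \<in> H" "C \<in> \<C> x" "D \<in> \<C> y" by blast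
    show "disjnt C D"
    proof (cases "x = y")
      case True
      then show ?thesis
        using \<C>[of x] xy \<open>C \<noteq> D\<close> unfolding pairwise_def by blast
    next
      case False
      then have "O' x \<inter> O' y = {}"
        using O xy by (simp add: disjoint_family_on_def)
      moreover have "C \<subseteq> O' x" "D \<subseteq> O' y"
        using \<C> xy by blast+
      ultimately show ?thesis
        by (auto simp: disjnt_def)
    qed
  qed
  moreover have "\<forall>U \<in> \<Union> (\<C> ` H). openin X U \<and> U \<noteq> {}"
    using \<C> by blast
  ultimately obtain Y where Y: "Y \<subseteq> topspace X" "Lindelof_space (subtopology X Y)"
      "\<forall>U \<in> \<Union> (\<C> ` H). U \<inter> Y \<noteq> {}"
    using X(3) unfolding cellular_Lindelof_space_def by meson
  have clo: "closedin X Y"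
    using closedin_Lindelof_subspace X Y by blast
  have "H \<subseteq> X closure_of Y"
    unfolding closure_of_def using H \<C> Y by fastforce
  then have sub: "X closure_of H \<subseteq> Y"
    using clo by (simp add: closure_of_closedin closure_of_minimal)
  have "closedin (subtopology X Y) (X closure_of H)"
    using sub by (simp add: closedin_subset_topspace)
  then have "Lindelof_space (subtopology (subtopology X Y) (X closure_of H))"
    using Lindelof_space_closedin_subtopology Y by blast
  then show ?thesis
    using sub by (simp add: subtopology_subtopology Int_absorb1)
qed

subsection \<open>Local bases and the cardinality bound\<close>

lemma local_base_at_subset: "local_base_at X x \<B> \<Longrightarrow> openin X U \<Longrightarrow> x \<in> U \<Longrightarrow> \<exists>B \<in> \<B>. B \<subseteq> U"
  by (simp add: local_base_at_def)

lemma local_base_at_openin: "local_base_at X x \<B> \<Longrightarrow> B \<in> \<B> \<Longrightarrow> openin X B \<and> x \<in> B"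
  by (simp add: local_base_at_def)

text \<open>Indexing all local bases by the same set, repetitions allowed, turns indices into
  colours that can be compared between different points.\<close>

lemma local_bases_bounded_by_indexed:
  assumes "local_bases_bounded_by X \<kappa>" "Cinfinite \<kappa>"
  obtains V where "\<And>x. x \<in> topspace X \<Longrightarrow> local_base_at X x (V x ` Field \<kappa>)"
proof -
  have "\<exists>v. local_base_at X x (v ` Field \<kappa>)" if x: "x \<in> topspace X" for x
  proof -
    obtain \<B> where \<B>: "local_base_at X x \<B>" "|\<B>| \<le>o \<kappa>"
      using assms(1) x unfolding local_bases_bounded_by_def by blast
    have "\<B> \<noteq> {}"
      using local_base_at_subset[OF \<B>(1) openin_topspace x] by blast
    then show ?thesis
      using ordLeq_Card_order_surj[OF \<B>(2)] assms(2) \<B>(1) by metis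
  qed
  then show thesis
    using that by metis
qed

lemma local_bases_separated:
  assumes "Hausdorff_space X" "x \<in> topspace X" "y \<in> topspace X" "x \<noteq> y"
    and "local_base_at X x \<B>" "local_base_at X y \<C>"
  obtains B C where "B \<in> \<B>" "C \<in> \<C>" "B \<inter> C = {}"
proof -
  obtain U W where UW: "openin X U" "openin X W" "x \<in> U" "y \<in> W" "disjnt U W"
    using assms(1-4) unfolding Hausdorff_space_def by meson
  obtain B where B: "B \<in> \<B>" "B \<subseteq> U"
    using local_base_at_subset[OF assms(5) UW(1,3)] by blast
  obtain C where C: "C \<in> \<C>" "C \<subseteq> W"
    using local_base_at_subset[OF assms(6) UW(2,4)] by blast
  show thesis
    using that[OF B(1) C(1)] B(2) C(2) UW(5) by (auto simp: disjnt_def)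
qed

text \<open>Tightness is at most character: pick one point of \<open>A\<close> from each basic
  neighbourhood of \<open>y\<close>.\<close>

lemma closure_of_witness:
  assumes "y \<in> X closure_of A" "|I| \<le>o \<kappa>" "local_base_at X y (V ` I)"
  obtains S where "S \<subseteq> A" "|S| \<le>o \<kappa>" "y \<in> X closure_of S"
proof -
  have y: "y \<in> topspace X"
    using assms(1) closure_of_subset_topspace by (metis subsetD)
  have "\<exists>a. a \<in> A \<inter> V i" if "i \<in> I" for i
    using assms(1) local_base_at_openin[OF assms(3), of "V i"] that unfolding in_closure_of by blast
  then obtain a where a: "\<And>i. i \<in> I \<Longrightarrow> a i \<in> A \<inter> V i"
    by metis
  have "y \<in> X closure_of (a ` I)"
    unfolding in_closure_of
  proof (intro conjI allI impI y)
    fix U assume U: "y \<in> U \<and> openin X U"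
    then obtain i where i: "i \<in> I" "V i \<subseteq> U"
      using local_base_at_subset[OF assms(3)] by blast
    then show "\<exists>z. z \<in> a ` I \<and> z \<in> U"
      using a[OF i(1)] by blast
  qed
  moreover have "|a ` I| \<le>o \<kappa>"
    using assms(2) card_of_image ordLeq_transitive by blast
  moreover have "a ` I \<subseteq> A"
    using a by blast
  ultimately show thesis
    using that by blast
qed

text \<open>A point \<open>y\<close> is coded by points \<open>a (i, j) \<in> V y i \<inter> V y j\<close> of \<open>S\<close>.  Two indices are needed: for
  distinct points \<open>x\<close>, \<open>y\<close> with \<open>V x i \<inter> V y j = {}\<close> the common value \<open>a (i, j)\<close> would lie in both.\<close>
lemma card_of_closure_of:
  fixes X :: "'a topology" and V :: "'a \<Rightarrow> 'b \<Rightarrow> 'a set" and \<kappa> :: "'b rel"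
  assumes \<kappa>: "Cinfinite \<kappa>" and X: "Hausdorff_space X"
    and V: "\<And>x. x \<in> topspace X \<Longrightarrow> local_base_at X x (V x ` Field \<kappa>)"
    and S: "|S| \<le>o \<kappa>"
  shows "|X closure_of S| \<le>o ctwo ^c \<kappa>"
proof -
  define J where "J = Field \<kappa> \<times> Field \<kappa>"
  have T: "y \<in> topspace X" if "y \<in> X closure_of S" for y
    using that closure_of_subset_topspace by (metis subsetD)
  have "\<exists>a. a \<in> Func J S \<and> (\<forall>i\<in>Field \<kappa>. \<forall>j\<in>Field \<kappa>. a (i, j) \<in> V y i \<inter> V y j)" if y: "y \<in> X closure_of S" for y
  proof -
    have "\<exists>z. z \<in> S \<inter> V y i \<inter> V y j" if "i \<in> Field \<kappa>" "j \<in> Field \<kappa>" for i j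
    proof -
      have "openin X (V y i \<inter> V y j)" "y \<in> V y i \<inter> V y j"
        using local_base_at_openin[OF V[OF T[OF y]]] that by (blast intro: openin_Int)+
      then show ?thesis
        using y unfolding in_closure_of by blast
    qed
    then obtain b where b: "\<And>i j. i \<in> Field \<kappa> \<Longrightarrow> j \<in> Field \<kappa> \<Longrightarrow> b i j \<in> S \<inter> V y i \<inter> V y j"
      by metis
    show ?thesis
      using b by (intro exI[of _ "\<lambda>p. if p \<in> J then b (fst p) (snd p) else undefined"])
        (auto simp: J_def Func_def)
  qed
  then obtain a where a: "\<And>y. y \<in> X closure_of S \<Longrightarrow> a y \<in> Func J S \<and>
      (\<forall>i\<in>Field \<kappa>. \<forall>j\<in>Field \<kappa>. a y (i, j) \<in> V y i \<inter> V y j)"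
    by metis
  have "inj_on a (X closure_of S)"
  proof (rule inj_onI, rule ccontr)
    fix x y assume xy: "x \<in> X closure_of S" "y \<in> X closure_of S" "a x = a y" "x \<noteq> y"
    obtain B C where BC: "B \<in> V x ` Field \<kappa>" "C \<in> V y ` Field \<kappa>" "B \<inter> C = {}"
      using local_bases_separated[OF X T[OF xy(1)] T[OF xy(2)] xy(4) V V] T xy by blast
    then obtain i j where "i \<in> Field \<kappa>" "j \<in> Field \<kappa>" "V x i \<inter> V y j = {}"
      by blast
    then show False
      using a[OF xy(1)] a[OF xy(2)] xy(3) by (metis IntD1 IntD2 IntI empty_iff)
  qed
  moreover have "a ` (X closure_of S) \<subseteq> Func J S"
    using a by blast
  ultimately have "|X closure_of S| \<le>o |Func J S|"
    using card_of_ordLeq by blast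
  moreover have "|S| \<le>o ctwo ^c \<kappa>"
    using S \<kappa> ordLess_ctwo_cexp ordLess_imp_ordLeq ordLeq_transitive by blast
  then have "|Func J S| \<le>o ctwo ^c \<kappa>"
    unfolding J_def using card_of_Func_ordLeq_cexp Cinfinite_Times_Field_ordLeq \<kappa> by blast
  ultimately show ?thesis
    using ordLeq_transitive by blast
qed

text \<open>The argument runs for any infinite \<kappa>. The contribution of cellular-Lindelofness
  and of the P-space property is isolated in the hypothesis \<open>Lin\<close>.\<close>

lemma card_topspace_ordLeq_cexp:
  fixes X :: "'a topology" and V :: "'a \<Rightarrow> 'b \<Rightarrow> 'a set" and \<kappa> :: "'b rel"
  assumes \<kappa>: "Cinfinite \<kappa>" and X: "Hausdorff_space X"
    and V: "\<And>x. x \<in> topspace X \<Longrightarrow> local_base_at X x (V x ` Field \<kappa>)"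
    and Lin: "\<And>H O'. \<lbrakk>\<And>x. x \<in> H \<Longrightarrow> openin X (O' x) \<and> x \<in> O' x; disjoint_family_on O' H\<rbrakk>
      \<Longrightarrow> Lindelof_space (subtopology X (X closure_of H))"
  shows "|topspace X| \<le>o ctwo ^c \<kappa>"
proof -
  define I where "I = Field \<kappa> \<times> Field \<kappa>"
  have I: "|I| \<le>o \<kappa>"
    unfolding I_def using Cinfinite_Times_Field_ordLeq \<kappa> by blast
  have I2: "|I| \<le>o ctwo ^c \<kappa>"
    using I \<kappa> ordLess_ctwo_cexp ordLess_imp_ordLeq ordLeq_transitive by blast
  have Vopen: "openin X (V x i)" "x \<in> V x i" if "x \<in> topspace X" "i \<in> Field \<kappa>" for x i
    using local_base_at_openin[OF V[OF that(1)]] that(2) by blast+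

  \<comment> \<open>The closed-off set \<open>A\<close>\<close>
  define valid where "valid S u q \<longleftrightarrow> q \<in> topspace X \<and> (\<forall>x\<in>S. V x (fst (u x)) \<inter> V q (snd (u x)) = {})"
    for S u q
  \<comment> \<open>The first part will make \<open>A\<close> closed in \<open>X\<close>; the second
    supplies one representative for each realisable pattern \<open>u\<close> of index pairs on
    \<open>S\<close>.\<close>
  define F where "F S = X closure_of S \<union> (\<lambda>u. SOME q. valid S u q) ` {u \<in> Func S I. \<exists>q. valid S u q}" for S
  have F_sub: "F S \<subseteq> topspace X" for S
  proof -
    have "(SOME q. valid S u q) \<in> topspace X" if "\<exists>q. valid S u q" for u
      using someI_ex[OF that] by (simp add: valid_def)
    then show ?thesis
      using closure_of_subset_topspace[of X S] by (auto simp: F_def)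
  qed
  have F_card: "|F S| \<le>o ctwo ^c \<kappa>" if S: "|S| \<le>o \<kappa>" for S
  proof -
    have "|{u \<in> Func S I. \<exists>q. valid S u q}| \<le>o |Func S I|"
      by (intro card_of_mono1) auto
    moreover have "|Func S I| \<le>o ctwo ^c \<kappa>"
      by (rule card_of_Func_ordLeq_cexp[OF \<kappa> S I2])
    ultimately have "|(\<lambda>u. SOME q. valid S u q) ` {u \<in> Func S I. \<exists>q. valid S u q}| \<le>o ctwo ^c \<kappa>"
      using card_of_image ordLeq_transitive by meson
    then show ?thesis
      unfolding F_def
      using card_of_closure_of[OF \<kappa> X V S] Cinfinite_two_cexp[OF \<kappa>] by (intro Un_Cinfinite_bound) auto
  qed
  obtain A' where A': "|A'| \<le>o ctwo ^c \<kappa>" "\<And>S. \<lbrakk>S \<subseteq> A'; |S| \<le>o \<kappa>\<rbrakk> \<Longrightarrow> F S \<subseteq> A'"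
    using closing_off[where F = F, OF \<kappa> F_card] by blast
  \<comment> \<open>\<open>A'\<close> may contain elements outside the space. As \<open>F\<close>
    takes values in subsets of \<open>topspace X\<close>, the intersection is still closed
    off.\<close>
  define A where "A = A' \<inter> topspace X"
  have A_top: "A \<subseteq> topspace X"
    by (simp add: A_def)
  have A_closed: "F S \<subseteq> A" if "S \<subseteq> A" "|S| \<le>o \<kappa>" for S
    using A'(2)[of S] F_sub that by (auto simp: A_def)
  have clo: "X closure_of H \<subseteq> A" if "H \<subseteq> A" for H
  proof
    fix y assume y: "y \<in> X closure_of H"
    then have "y \<in> topspace X"
      using closure_of_subset_topspace by (metis subsetD)
    then obtain S where S: "S \<subseteq> H" "|S| \<le>o \<kappa>" "y \<in> X closure_of S"
      using closure_of_witness[OF y Cinfinite_Field_ordLeq[OF \<kappa>] V] by blast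
    then have "F S \<subseteq> A"
      using A_closed that by (meson order_trans)
    then show "y \<in> A"
      using S(3) by (auto simp: F_def)
  qed
  have "topspace X \<subseteq> A"
  proof (rule subsetI, rule ccontr)
    fix p assume p: "p \<in> topspace X" "p \<notin> A"
    have "\<exists>c \<in> I. V x (fst c) \<inter> V p (snd c) = {}" if x: "x \<in> A" for x
    proof -
      have xT: "x \<in> topspace X" "x \<noteq> p"
        using x A_top p(2) by blast+
      obtain B C where "B \<in> V x ` Field \<kappa>" "C \<in> V p ` Field \<kappa>" "B \<inter> C = {}"
        using local_bases_separated[OF X xT(1) p(1) xT(2) V[OF xT(1)] V[OF p(1)]] by blast
      then show ?thesis
        by (auto simp: I_def)
    qed
    then obtain u where u: "\<And>x. x \<in> A \<Longrightarrow> u x \<in> I \<and> V x (fst (u x)) \<inter> V p (snd (u x)) = {}"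
      by metis
    define W where "W x = V x (fst (u x))" for x
    have W: "openin X (W x)" "x \<in> W x" if "x \<in> A" for x
      using Vopen[of x "fst (u x)"] u[OF that] that A_top by (auto simp: W_def I_def)
    \<comment> \<open>The point \<open>p\<close> itself realises the pattern \<open>u\<close> on
      \<open>S\<close>, so the representative chosen by \<open>F\<close> does too, and it lies in
      \<open>A\<close>.\<close>
    have extend: "\<exists>q\<in>A. \<forall>x\<in>S. W x \<inter> V q (snd (u x)) = {}" if S: "S \<subseteq> A" "|S| \<le>o \<kappa>" for S
    proof -
      define v where "v x = (if x \<in> S then u x else undefined)" for x
      have v: "v \<in> Func S I"
        using u S by (auto simp: v_def Func_def)
      have ex: "\<exists>q. valid S v q"
        using u S p by (auto simp: valid_def v_def)
      have "valid S v (SOME q. valid S v q)"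
        using someI_ex[OF ex] .
      moreover have "(SOME q. valid S v q) \<in> A"
        using A_closed[OF S] v ex unfolding F_def by blast
      ultimately show ?thesis
        by (auto simp: valid_def v_def W_def)
    qed
    \<comment> \<open>When the closure of \<open>H\<close> is Lindelof, it lies in \<open>A\<close>
      and is thus covered by the sets \<open>W x\<close>; \<open>E H\<close> indexes a countable
      subcover.\<close>
    have "\<exists>E. E \<subseteq> A \<and> countable E \<and>
        (H \<subseteq> A \<and> Lindelof_space (subtopology X (X closure_of H)) \<longrightarrow> X closure_of H \<subseteq> \<Union> (W ` E))" for H
    proof (cases "H \<subseteq> A \<and> Lindelof_space (subtopology X (X closure_of H))")
      case True
      then have "(\<forall>U \<in> W ` A. openin X U) \<and> X closure_of H \<subseteq> \<Union> (W ` A)"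
        using W clo by blast
      then obtain \<V> where "countable \<V>" "\<V> \<subseteq> W ` A" "X closure_of H \<subseteq> \<Union> \<V>"
        using True Lindelof_space_subtopology_subset[OF closure_of_subset_topspace] by metis
      then show ?thesis
        by (metis countable_subset_image)
    qed auto
    then obtain E where E: "\<And>H. E H \<subseteq> A \<and> countable (E H) \<and>
        (H \<subseteq> A \<and> Lindelof_space (subtopology X (X closure_of H)) \<longrightarrow> X closure_of H \<subseteq> \<Union> (W ` E H))"
      by metis

    \<comment> \<open>Transfinite choice of points along \<kappa>^+\<close>
    define r where "r = cardSuc \<kappa>"
    have r: "Card_order r" "Well_order r" "Cinfinite r" "\<not> |Field r| \<le>o \<kappa>"
    proof -
      show "Card_order r" "Well_order r" "Cinfinite r"
        using \<kappa> by (auto simp: r_def cardSuc_Well_order Cinfinite_cardSuc cardSuc_Card_order)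
      then have "r =o |Field r|"
        using card_of_Field_ordIso ordIso_symmetric by blast
      moreover have "\<kappa> <o r"
        using \<kappa> by (simp add: r_def cardSuc_greater)
      ultimately show "\<not> |Field r| \<le>o \<kappa>"
        using ordLess_ordIso_trans not_ordLess_ordLeq by blast
    qed
    have under_card: "|underS r \<alpha>| \<le>o \<kappa>" if "\<alpha> \<in> Field r" for \<alpha>
      using card_of_underS[OF r(1) that] cardSuc_ordLeq_ordLess[of \<kappa> "|underS r \<alpha>|"] \<kappa>
      by (simp add: r_def card_of_Card_order)
    have under_trans: "underS r \<beta> \<subseteq> underS r \<alpha>" if "(\<beta>, \<alpha>) \<in> r" for \<alpha> \<beta>
      using that underS_incr[of r \<beta> \<alpha>] r(2) unfolding order_on_defs by blast
    \<comment> \<open>\<open>E\<close> is not monotone, so the covers chosen at all earlier stages \<open>\<beta>\<close> have to be included.\<close>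
    define K where "K f \<alpha> = f ` underS r \<alpha> \<union>
        (\<Union>\<beta> \<in> insert \<alpha> (underS r \<alpha>). \<Union>c \<in> I. E {x \<in> f ` underS r \<beta>. u x = c})" for f \<alpha>
    have K_card: "|K f \<alpha>| \<le>o \<kappa>" if "\<alpha> \<in> Field r" for f \<alpha>
    proof -
      have "|{\<alpha>} \<union> underS r \<alpha>| \<le>o \<kappa>"
        using under_card[OF that] \<kappa> by (intro Un_Cinfinite_bound[OF finite_ordLeq_Cinfinite]) simp_all
      moreover have "|f ` underS r \<alpha>| \<le>o \<kappa>"
        using under_card[OF that] card_of_image ordLeq_transitive by blast
      moreover have "|E H| \<le>o \<kappa>" for H
        using E \<kappa> countable_ordLeq_Cinfinite by blast
      ultimately show ?thesis
        unfolding K_def using \<kappa> I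
        by (intro Un_Cinfinite_bound UNION_Cinfinite_bound ballI) simp_all
    qed
    \<comment> \<open>The new point \<open>q\<close> must imitate \<open>p\<close> towards all
      earlier points and towards the centres of all covers chosen so far.\<close>
    define P where "P f \<alpha> q \<longleftrightarrow> \<alpha> \<in> Field r \<longrightarrow> q \<in> A \<and> (\<forall>x \<in> K f \<alpha>. W x \<inter> V q (snd (u x)) = {})" for f \<alpha> q
    have "\<exists>f. \<forall>\<alpha>. P f \<alpha> (f \<alpha>)"
    proof (rule dependent_wf_choice)
      show "wf (r - Id)"
        using r by (simp add: well_order_on_def)
      show "P f \<alpha> q = P g \<alpha> q" if fg: "\<And>\<beta>. (\<beta>, \<alpha>) \<in> r - Id \<Longrightarrow> f \<beta> = g \<beta>" for f g \<alpha> q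
      proof -
        have "f ` underS r \<beta> = g ` underS r \<beta>" if "\<beta> \<in> insert \<alpha> (underS r \<alpha>)" for \<beta>
        proof (rule image_cong)
          fix \<gamma> assume "\<gamma> \<in> underS r \<beta>"
          then have "\<gamma> \<in> underS r \<alpha>"
            using that under_trans[of \<beta> \<alpha>] by (auto simp: underS_def)
          then show "f \<gamma> = g \<gamma>"
            using fg by (auto simp: underS_def)
        qed simp
        then have "K f \<alpha> = K g \<alpha>"
          unfolding K_def by simp
        then show ?thesis
          by (simp add: P_def)
      qed
      show "\<exists>q. P f \<alpha> q" if IH: "\<And>\<beta>. (\<beta>, \<alpha>) \<in> r - Id \<Longrightarrow> P f \<beta> (f \<beta>)" for f \<alpha>
      proof (cases "\<alpha> \<in> Field r")
        case True
        have "f ` underS r \<alpha> \<subseteq> A"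
          using IH by (auto simp: P_def underS_def Field_def)
        then have "K f \<alpha> \<subseteq> A"
          unfolding K_def using E by blast
        then show ?thesis
          using extend[OF _ K_card[OF True]] unfolding P_def by blast
      qed (simp add: P_def)
    qed
    then obtain f where f: "\<And>\<alpha>. P f \<alpha> (f \<alpha>)"
      by blast
    have fA: "f \<alpha> \<in> A" if "\<alpha> \<in> Field r" for \<alpha>
      using f[of \<alpha>] that by (simp add: P_def)
    have fK: "W x \<inter> V (f \<alpha>) (snd (u x)) = {}" if "\<alpha> \<in> Field r" "x \<in> K f \<alpha>" for \<alpha> x
      using f[of \<alpha>] that by (simp add: P_def)
    \<comment> \<open>Since \<open>f \<alpha>\<close> lies in each of its own basic neighbourhoods,
      imitating \<open>p\<close> keeps it outside the covering sets \<open>W x\<close>.\<close>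
    have avoid: "f \<alpha> \<notin> W x" if "\<alpha> \<in> Field r" "x \<in> K f \<alpha>" "x \<in> A" for \<alpha> x
    proof -
      have "f \<alpha> \<in> V (f \<alpha>) (snd (u x))"
        using Vopen[of "f \<alpha>" "snd (u x)"] fA[OF that(1)] A_top u[OF that(3)] by (auto simp: I_def)
      then show ?thesis
        using fK[OF that(1,2)] by blast
    qed
    have cmp: "\<alpha> \<in> underS r \<beta> \<or> \<beta> \<in> underS r \<alpha>" if "\<alpha> \<in> Field r" "\<beta> \<in> Field r" "\<alpha> \<noteq> \<beta>" for \<alpha> \<beta>
      using r(2) that unfolding well_order_on_def linear_order_on_def total_on_def underS_def by auto
    have neq: "f \<beta> \<noteq> f \<alpha>" if "\<beta> \<in> underS r \<alpha>" for \<alpha> \<beta>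
    proof -
      have "\<alpha> \<in> Field r" "\<beta> \<in> Field r"
        using that by (auto simp: underS_def Field_def)
      then show ?thesis
        using avoid[of \<alpha> "f \<beta>"] fA W(2) that by (auto simp: K_def)
    qed
    have inj: "inj_on f (Field r)"
      using cmp neq by (metis inj_onI)

    \<comment> \<open>A homogeneous set of size \<kappa>^+\<close>
    have "\<exists>c\<in>I. \<not> |{\<alpha> \<in> Field r. u (f \<alpha>) = c}| \<le>o \<kappa>"
    proof (rule ccontr)
      assume "\<not> ?thesis"
      then have "|\<Union>c\<in>I. {\<alpha> \<in> Field r. u (f \<alpha>) = c}| \<le>o \<kappa>"
        using I \<kappa> by (intro UNION_Cinfinite_bound) auto
      moreover have "(\<Union>c\<in>I. {\<alpha> \<in> Field r. u (f \<alpha>) = c}) = Field r"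
        using u fA by auto
      ultimately show False
        using r(4) by simp
    qed
    then obtain c where c: "c \<in> I" "\<not> |{\<alpha> \<in> Field r. u (f \<alpha>) = c}| \<le>o \<kappa>"
      by blast
    define T where "T = {\<alpha> \<in> Field r. u (f \<alpha>) = c}"
    define H where "H = f ` T"
    have T_sub: "T \<subseteq> Field r"
      by (auto simp: T_def)
    have HA: "H \<subseteq> A"
      using fA by (auto simp: H_def T_def)
    have H_card: "\<not> |H| \<le>o \<kappa>"
    proof
      assume "|H| \<le>o \<kappa>"
      moreover have "|T| \<le>o |H|"
        unfolding H_def using inj T_sub card_of_ordLeq[of T "f ` T"] inj_on_subset by blast
      ultimately show False
        using c(2) ordLeq_transitive unfolding T_def by blast
    qed
    \<comment> \<open>Of two points in \<open>H\<close>, the earlier uses the first index of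
      \<open>c\<close> and the later the second. Intersecting both neighbourhoods serves either
      role.\<close>
    define N where "N x = V x (fst c) \<inter> V x (snd c)" for x
    have N: "openin X (N x) \<and> x \<in> N x" if "x \<in> H" for x
      using Vopen[of x] that HA A_top c(1) by (auto simp: N_def I_def intro!: openin_Int)
    have N_lt: "N (f \<alpha>) \<inter> N (f \<beta>) = {}" if "\<alpha> \<in> T" "\<beta> \<in> T" "\<beta> \<in> underS r \<alpha>" for \<alpha> \<beta>
    proof -
      have "W (f \<beta>) \<inter> V (f \<alpha>) (snd (u (f \<beta>))) = {}"
        using that by (intro fK) (auto simp: T_def K_def)
      then show ?thesis
        using that by (auto simp: N_def W_def T_def)
    qed
    have N_disj: "disjoint_family_on N H"
      unfolding disjoint_family_on_def
    proof (intro ballI impI)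
      fix x y assume "x \<in> H" "y \<in> H" "x \<noteq> y"
      then obtain \<alpha> \<beta> where *: "\<alpha> \<in> T" "\<beta> \<in> T" "\<alpha> \<noteq> \<beta>" "x = f \<alpha>" "y = f \<beta>"
        by (auto simp: H_def)
      then consider "\<alpha> \<in> underS r \<beta>" | "\<beta> \<in> underS r \<alpha>"
        using cmp T_sub by blast
      then show "N x \<inter> N y = {}"
        using N_lt * by cases blast+
    qed
    have Lin_sub: "Lindelof_space (subtopology X (X closure_of H'))" if "H' \<subseteq> H" for H'
      using that N N_disj by (intro Lin[of H' N]) (auto intro: disjoint_family_on_mono)
    \<comment> \<open>The point \<open>y\<close> is in the closure of at most \<kappa> points of
      \<open>H\<close>. By regularity their indices lie below some \<alpha>, so \<open>y\<close> is
      in the cover chosen for the part of \<open>H\<close> before \<alpha>, which all points from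
      \<alpha> on avoid.\<close>
    have "\<exists>G. openin X G \<and> y \<in> G \<and> |G \<inter> H| \<le>o \<kappa>" if y: "y \<in> X closure_of H" for y
    proof -
      have yT: "y \<in> topspace X"
        using y closure_of_subset_topspace by (metis subsetD)
      obtain S where S: "S \<subseteq> H" "|S| \<le>o \<kappa>" "y \<in> X closure_of S"
        using closure_of_witness[OF y Cinfinite_Field_ordLeq[OF \<kappa>] V[OF yT]] by blast
      obtain T' where T': "T' \<subseteq> T" "S = f ` T'"
        using S(1) unfolding H_def by (metis subset_imageE)
      have "|T'| \<le>o |S|"
        using T' inj T_sub card_of_ordLeq[of T' S] inj_on_subset by (metis order_refl subset_trans)
      then have "|T'| \<le>o \<kappa>"
        using S(2) ordLeq_transitive by blast
      moreover have "T' \<subseteq> (\<Union>\<alpha>\<in>Field r. underS r \<alpha>)"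
      proof
        fix \<beta> assume "\<beta> \<in> T'"
        then have "\<beta> \<in> Field r"
          using T' T_sub by blast
        then show "\<beta> \<in> (\<Union>\<alpha>\<in>Field r. underS r \<alpha>)"
          using infinite_Card_order_limit[of r \<beta>] r by (auto simp: cinfinite_def underS_def)
      qed
      moreover have "relChain r (underS r)"
        using under_trans by (auto simp: relChain_def)
      ultimately obtain \<alpha> where \<alpha>: "\<alpha> \<in> Field r" "T' \<subseteq> underS r \<alpha>"
        using cardSuc_UNION_Cinfinite[of \<kappa> "underS r" T'] \<kappa> unfolding r_def by blast
      \<comment> \<open>Passing from \<open>S\<close> to all points of colour \<open>c\<close>
        before \<alpha> yields a set whose cover \<open>E H'\<close> is included in
        \<open>K f \<gamma>\<close> for every \<gamma> from \<alpha> on.\<close>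
      define H' where "H' = {x \<in> f ` underS r \<alpha>. u x = c}"
      have H': "H' \<subseteq> H"
        unfolding H'_def H_def T_def by (auto simp: underS_def Field_def)
      have "S \<subseteq> H'"
        using T' \<alpha>(2) by (auto simp: H'_def T_def)
      then have "y \<in> X closure_of H'"
        using S(3) closure_of_mono by blast
      moreover have "X closure_of H' \<subseteq> \<Union> (W ` E H')"
        using E[of H'] Lin_sub[OF H'] H' HA by blast
      ultimately have "y \<in> \<Union> (W ` E H')"
        by blast
      moreover have "openin X (\<Union> (W ` E H'))"
        using W(1) E by blast
      moreover have "\<Union> (W ` E H') \<inter> H \<subseteq> f ` underS r \<alpha>"
      proof (rule subsetI, rule ccontr)
        fix x assume x: "x \<in> \<Union> (W ` E H') \<inter> H" "x \<notin> f ` underS r \<alpha>"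
        then obtain e \<gamma> where e: "e \<in> E H'" "f \<gamma> \<in> W e" "\<gamma> \<in> T" "x = f \<gamma>"
          by (auto simp: H_def)
        then have \<gamma>: "\<gamma> \<in> Field r" "\<gamma> \<notin> underS r \<alpha>"
          using T_sub x(2) by blast+
        then have "\<alpha> \<in> insert \<gamma> (underS r \<gamma>)"
          using cmp[of \<alpha> \<gamma>] \<alpha>(1) by blast
        then have "e \<in> K f \<gamma>"
          unfolding K_def using e(1) c(1) unfolding H'_def by blast
        then show False
          using avoid[OF \<gamma>(1)] e(1,2) E[of H'] by blast
      qed
      then have "|\<Union> (W ` E H') \<inter> H| \<le>o |f ` underS r \<alpha>|"
        by (rule card_of_mono1)
      then have "|\<Union> (W ` E H') \<inter> H| \<le>o \<kappa>"
        using under_card[OF \<alpha>(1)] card_of_image ordLeq_transitive by meson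
      ultimately show ?thesis
        by blast
    qed
    then obtain G where G: "\<And>y. y \<in> X closure_of H \<Longrightarrow> openin X (G y) \<and> y \<in> G y \<and> |G y \<inter> H| \<le>o \<kappa>"
      by metis
    \<comment> \<open>Countably many sets \<open>G y\<close> cover \<open>H\<close>, each meeting it
      in at most \<kappa> points, which contradicts the size of \<open>H\<close>.\<close>
    have "(\<forall>U \<in> G ` (X closure_of H). openin X U) \<and> X closure_of H \<subseteq> \<Union> (G ` (X closure_of H))"
      using G by blast
    then obtain \<V> where "countable \<V>" "\<V> \<subseteq> G ` (X closure_of H)" "X closure_of H \<subseteq> \<Union> \<V>"
      using Lin_sub[of H] Lindelof_space_subtopology_subset[OF closure_of_subset_topspace] by (metis order_refl)
    then obtain C where C: "countable C" "C \<subseteq> X closure_of H" "X closure_of H \<subseteq> \<Union> (G ` C)"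
      by (metis countable_subset_image)
    have "H \<subseteq> X closure_of H"
      using HA A_top by (intro closure_of_subset) blast
    then have "H \<subseteq> (\<Union>y\<in>C. G y \<inter> H)"
      using C(3) by blast
    moreover have "|\<Union>y\<in>C. G y \<inter> H| \<le>o \<kappa>"
      using C G \<kappa> by (intro UNION_Cinfinite_bound[OF countable_ordLeq_Cinfinite]) blast+
    ultimately show False
      using H_card card_of_mono1 ordLeq_transitive by blast
  qed
  then show ?thesis
    using A'(1) card_of_mono1[of "topspace X" A'] ordLeq_transitive unfolding A_def by blast
qed

theorem corollary13:
  fixes X :: "'a topology"
  assumes "Hausdorff_space X"
    and "cellular_Lindelof_space X"
    and "P_space X"
    and "has_character X omega_1"
  shows "|topspace X| \<le>o ctwo ^c omega_1"
proof -
  have "local_bases_bounded_by X omega_1"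
    using assms(4) by (simp add: has_character_def)
  then obtain V where V: "\<And>x. x \<in> topspace X \<Longrightarrow> local_base_at X x (V x ` Field omega_1)"
    using local_bases_bounded_by_indexed[OF _ Cinfinite_omega_1] by blast
  show ?thesis
    using Cinfinite_omega_1 assms(1) V
  proof (rule card_topspace_ordLeq_cexp)
    show "Lindelof_space (subtopology X (X closure_of H))"
      if "\<And>x. x \<in> H \<Longrightarrow> openin X (O' x) \<and> x \<in> O' x" "disjoint_family_on O' H" for H O'
      using Lindelof_closure_of_separated[OF assms(1,3,2) V that] .
  qed
qed

end
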